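(* There are uncountably many pairwise coarsely inequivalent asymptotically $0$-dimensional subspaces of the ray $\mathbb{R}_+=[0,\infty)$; that is, there is an uncountable family of subspaces of $\mathbb{R}_+$ (with the induced metric), each of asymptotic dimension zero, no two distinct members of which are coarsely equivalent.
   Context: A metric space $X$ has asymptotic dimension zero if for every $S>0$ there is $D>0$ such that every $S$-component of $X$ has diameter at most $D$. Here an $S$-component is a maximal subset in which any two points can be joined by a finite sequence of points of the subset with consecutive distances $\le S$. A map $f\colon X\to Y$ of metric spaces is coarse if it is metrically proper (preimages of bounded sets are bounded) and large scale uniform: there is a nondecreasing function $\delta_f\colon[0,\infty)\to[0,\infty)$ with $d_Y(f(x),f(x'))\le\delta_f(d_X(x,x'))$ for all $x,x'$. $X$ and $Y$ are coarsely equivalent if there are a constant $C>0$ and coarse maps $f\colon X\to Y$, $g\colon Y\to X$ such that $g\circ f$ and $f\circ g$ are $C$-close to the respective identity maps. *)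

theory Defs
  imports "HOL-Analysis.Analysis"
begin

text \<open>
  A metric space is a set \<open>X\<close> in a type of class \<open>metric_space\<close>, carrying the induced metric.
\<close>

definition scale_connected :: "real \<Rightarrow> 'a::metric_space set \<Rightarrow> bool" where
  "scale_connected S A \<longleftrightarrow>
     (\<forall>x\<in>A. \<forall>y\<in>A. \<exists>(p :: nat \<Rightarrow> 'a) n.
        p 0 = x \<and> p n = y \<and> (\<forall>i\<le>n. p i \<in> A) \<and> (\<forall>i<n. dist (p i) (p (Suc i)) \<le> S))"

definition scale_component :: "real \<Rightarrow> 'a::metric_space set \<Rightarrow> 'a set \<Rightarrow> bool" where
  "scale_component S X A \<longleftrightarrow>
     A \<subseteq> X \<and> scale_connected S A \<and>
     (\<forall>B. A \<subseteq> B \<and> B \<subseteq> X \<and> scale_connected S B \<longrightarrow> B = A)"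

text \<open>
  The real-valued \<open>diameter\<close> is meaningful only for bounded sets, hence the conjunct \<open>bounded A\<close>.
\<close>

definition asdim_zero :: "'a::metric_space set \<Rightarrow> bool" where
  "asdim_zero X \<longleftrightarrow>
     (\<forall>S>0. \<exists>D>0. \<forall>A. scale_component S X A \<longrightarrow> bounded A \<and> diameter A \<le> D)"

definition metrically_proper ::
    "'a::metric_space set \<Rightarrow> 'b::metric_space set \<Rightarrow> ('a \<Rightarrow> 'b) \<Rightarrow> bool" where
  "metrically_proper X Y f \<longleftrightarrow> (\<forall>B. B \<subseteq> Y \<and> bounded B \<longrightarrow> bounded (f -` B \<inter> X))"

definition large_scale_uniform ::
    "'a::metric_space set \<Rightarrow> ('a \<Rightarrow> 'b::metric_space) \<Rightarrow> bool" where
  "large_scale_uniform X f \<longleftrightarrow>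
     (\<exists>\<delta> :: real \<Rightarrow> real. \<delta> \<in> {0..} \<rightarrow> {0..} \<and> mono_on {0..} \<delta> \<and>
        (\<forall>x\<in>X. \<forall>x'\<in>X. dist (f x) (f x') \<le> \<delta> (dist x x')))"

definition coarse_map ::
    "'a::metric_space set \<Rightarrow> 'b::metric_space set \<Rightarrow> ('a \<Rightarrow> 'b) \<Rightarrow> bool" where
  "coarse_map X Y f \<longleftrightarrow> f \<in> X \<rightarrow> Y \<and> metrically_proper X Y f \<and> large_scale_uniform X f"

definition coarsely_equivalent ::
    "'a::metric_space set \<Rightarrow> 'b::metric_space set \<Rightarrow> bool" where
  "coarsely_equivalent X Y \<longleftrightarrow>
     (\<exists>C>0. \<exists>f g. coarse_map X Y f \<and> coarse_map Y X g \<and>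
        (\<forall>x\<in>X. dist (g (f x)) x \<le> C) \<and> (\<forall>y\<in>Y. dist (f (g y)) y \<le> C))"

end

theory Submission
  imports Defs
begin

text \<open>
  Place blocks ever further apart along the ray, each an arithmetic progression of \<open>n\<close> points with
  step \<open>n\<close>, so that every \<open>n\<close> from a given set \<open>A\<close> is the width of infinitely many blocks and no
  other width occurs. A coarse equivalence carries a sufficiently far block of large width \<open>n\<close>
  injectively into a single block, of width \<open>m\<close> say, and the inverse equivalence carries the latter
  injectively back into the former; comparing cardinalities, \<open>n = m\<close>. Hence \<open>A\<close> is determined up to
  finitely many elements by the coarse type of the space, and there are uncountably many subsets of
  the natural numbers with pairwise infinite symmetric difference.
\<close>

section \<open>Blocks on the ray and the distances between their points\<close>

definition width :: "nat \<Rightarrow> nat" where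
  "width j = fst (prod_decode j)"

text \<open>The cubes leave ever larger gaps: as \<open>width j \<le> j\<close>, the block ends by
  \<open>j ^ 3 + j ^ 2\<close>, well before \<open>(j + 1) ^ 3\<close>.\<close>

definition block_point :: "nat \<Rightarrow> nat \<Rightarrow> real" where
  "block_point j i = real (j ^ 3 + i * width j)"

definition block :: "nat \<Rightarrow> real set" where
  "block j = block_point j ` {..<width j}"

definition block_space :: "nat set \<Rightarrow> real set" where
  "block_space A = (\<Union>j\<in>{j. width j \<in> A}. block j)"

lemma width_le: "width j \<le> j"
proof -
  obtain a b where ab: "prod_decode j = (a, b)" by (cases "prod_decode j") auto
  then have "prod_encode (a, b) = j" using prod_decode_inverse[of j] by simp
  then show ?thesis using ab le_prod_encode_1[of a b] by (simp add: width_def)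
qed

text \<open>Letting \<open>i\<close> vary gives blocks of width \<open>n\<close> arbitrarily far
  out.\<close>

lemma width_prod_encode [simp]: "width (prod_encode (n, i)) = n"
  by (simp add: width_def)

lemma block_lower: "x \<in> block j \<Longrightarrow> real j ^ 3 \<le> x"
  by (auto simp: block_def block_point_def)

lemma block_upper:
  assumes "x \<in> block j"
  shows "x \<le> real j ^ 3 + real j ^ 2"
proof -
  obtain i where i: "i < width j" "x = block_point j i" using assms by (auto simp: block_def)
  have "i * width j \<le> j * j" using i(1) width_le[of j] by (intro mult_mono) auto
  then have "real (i * width j) \<le> real (j * j)" by (rule of_nat_mono)
  then show ?thesis using i(2) by (simp add: block_point_def power2_eq_square)
qed

lemma dist_distinct_blocks_aux:
  assumes "x \<in> block j" "y \<in> block k" "j < k"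
  shows "real k \<le> y - x"
proof -
  obtain l where l: "k = Suc l" using assms(3) by (cases k) auto
  have "x \<le> real j ^ 3 + real j ^ 2" using block_upper[OF assms(1)] .
  also have "\<dots> \<le> real l ^ 3 + real l ^ 2"
    using assms(3) l by (intro add_mono power_mono) auto
  \<comment> \<open>The two sides differ by \<open>2 * l ^ 2 + 2 * l\<close>.\<close>
  also have "\<dots> \<le> (1 + real l) ^ 3 - (1 + real l)"
    by (simp add: power2_eq_square power3_eq_cube algebra_simps)
  also have "\<dots> = real k ^ 3 - real k" using l by simp
  also have "\<dots> \<le> y - real k" using block_lower[OF assms(2)] by simp
  finally show ?thesis by simp
qed

text \<open>The gap is at least the larger index, so either index bounds it. Later only one of the
  two indices is known to be large.\<close>

lemma dist_distinct_blocks: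
  assumes "x \<in> block j" "y \<in> block k" "j \<noteq> k"
  shows "real j \<le> dist x y"
proof (cases "j < k")
  case True
  then show ?thesis using dist_distinct_blocks_aux[OF assms(1,2)] by (simp add: dist_real_def)
next
  case False
  then show ?thesis
    using dist_distinct_blocks_aux[OF assms(2,1)] assms(3) by (simp add: dist_real_def)
qed

lemma dist_block_points: "dist (block_point j i) (block_point j i') = \<bar>real i - real i'\<bar> * width j"
proof -
  have "block_point j i - block_point j i' = (real i - real i') * width j"
    by (simp add: block_point_def algebra_simps)
  then show ?thesis by (simp add: dist_real_def abs_mult)
qed

lemma dist_within_block:
  assumes "x \<in> block j" "y \<in> block j" "x \<noteq> y"
  shows "real (width j) \<le> dist x y"
proof -
  obtain i i' where i: "x = block_point j i" "y = block_point j i'"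
    using assms by (auto simp: block_def)
  then have "i \<noteq> i'" using assms(3) by auto
  then have "1 \<le> \<bar>real i - real i'\<bar>" by linarith
  then show ?thesis
    using i mult_right_mono[of 1 "\<bar>real i - real i'\<bar>" "real (width j)"]
    by (simp add: dist_block_points)
qed

lemma dist_block_le:
  assumes "x \<in> block j" "y \<in> block j"
  shows "dist x y \<le> real (width j) ^ 2"
proof -
  obtain i i' where i: "x = block_point j i" "y = block_point j i'" "i < width j" "i' < width j"
    using assms by (auto simp: block_def)
  then have "\<bar>real i - real i'\<bar> * width j \<le> real (width j) * width j"
    by (intro mult_right_mono) auto
  then show ?thesis using i by (simp add: dist_block_points power2_eq_square)
qed

lemma finite_block: "finite (block j)"
  by (simp add: block_def)

lemma card_block: "card (block j) = width j"
proof -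
  have "inj_on (block_point j) {..<width j}"
    by (auto simp: inj_on_def block_point_def)
  then show ?thesis by (simp add: block_def card_image)
qed

lemma block_subset_space: "width j \<in> A \<Longrightarrow> block j \<subseteq> block_space A"
  by (auto simp: block_space_def)

lemma in_block_space:
  assumes "x \<in> block_space A"
  obtains j where "width j \<in> A" "x \<in> block j"
  using assms by (auto simp: block_space_def)

text \<open>Blocks of index at most \<open>M\<close> end by \<open>M ^ 3 + M ^ 2\<close>. This turns
  properness of a map into a lower bound on the index of a block.\<close>

lemma block_index_gt:
  assumes "x \<in> block j" "M ^ 3 + M ^ 2 < x" "0 \<le> M"
  shows "M < real j"
proof (rule ccontr)
  assume "\<not> M < real j"
  then have "real j ^ 3 + real j ^ 2 \<le> M ^ 3 + M ^ 2"
    by (intro add_mono power_mono) auto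
  then show False using block_upper[OF assms(1)] assms(2) by linarith
qed

section \<open>Asymptotic dimension zero\<close>

text \<open>Steps of length at most \<open>S\<close> cannot cross the gap around a block of index
  above \<open>S\<close>, and cannot reach another point of it when its width exceeds
  \<open>S\<close>.\<close>

lemma chain_in_block:
  assumes "scale_connected S A" "A \<subseteq> block_space B" "x \<in> A" "x \<in> block j" "S < real j" "y \<in> A"
  shows "y \<in> block j" "S < real (width j) \<Longrightarrow> y = x"
proof -
  obtain p n where p: "p 0 = x" "p n = y" "\<forall>i\<le>n. p i \<in> A"
      "\<forall>i<n. dist (p i) (p (Suc i)) \<le> S"
    using assms(1)[unfolded scale_connected_def, rule_format, OF assms(3,6)] by auto
  have *: "p i \<in> block j \<and> (S < real (width j) \<longrightarrow> p i = x)" if "i \<le> n" for i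
    using that
  proof (induction i)
    case 0
    then show ?case using p(1) assms(4) by simp
  next
    case (Suc i)
    have "p (Suc i) \<in> block_space B" using p(3) Suc.prems assms(2) by auto
    then obtain k where k: "p (Suc i) \<in> block k" by (rule in_block_space)
    have d: "dist (p i) (p (Suc i)) \<le> S" using p(4) Suc.prems by simp
    have IH: "p i \<in> block j" "S < real (width j) \<longrightarrow> p i = x"
      using Suc.IH Suc.prems by simp_all
    have "k = j"
    proof (rule ccontr)
      assume "k \<noteq> j"
      then show False using dist_distinct_blocks[OF IH(1) k] d assms(5) by linarith
    qed
    then have pj: "p (Suc i) \<in> block j" using k by simp
    moreover have "p (Suc i) = x" if "S < real (width j)"
    proof (rule ccontr)
      assume "p (Suc i) \<noteq> x"
      then have "p i \<noteq> p (Suc i)" using IH(2) that by auto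
      then show False using dist_within_block[OF IH(1) pj] d that by linarith
    qed
    ultimately show ?case by blast
  qed
  show "y \<in> block j" "S < real (width j) \<Longrightarrow> y = x" using *[of n] p(2) by simp_all
qed

lemma block_space_nonneg: "block_space A \<subseteq> {0..}"
  by (auto simp: block_space_def block_def block_point_def)

lemma asdim_zero_block_space: "asdim_zero (block_space A)"
  unfolding asdim_zero_def
proof (intro allI impI)
  fix S :: real assume S: "0 < S"
  \<comment> \<open>\<open>S ^ 3 + S ^ 2\<close> bounds all points in blocks of index at most
    \<open>S\<close>; the summand \<open>S ^ 2\<close> alone bounds the distances in a block of
    width at most \<open>S\<close>.\<close>
  define D where "D = S ^ 3 + S ^ 2"
  have D: "0 < D" using S by (simp add: D_def add_pos_pos)
  have "bounded K \<and> diameter K \<le> D" if K: "scale_component S (block_space A) K" for K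
  proof -
    have K': "K \<subseteq> block_space A" "scale_connected S K"
      using K by (auto simp: scale_component_def)
    have dist: "dist x y \<le> D" if xy: "x \<in> K" "y \<in> K" for x y
    proof -
      obtain j k where jk: "x \<in> block j" "y \<in> block k"
        using xy K'(1) in_block_space by (meson subsetD)
      consider "S < real j" | "S < real k" "real j \<le> S" | "real j \<le> S" "real k \<le> S" by linarith
      then show ?thesis
      proof cases
        case 1
        have *: "y \<in> block j" "S < real (width j) \<Longrightarrow> y = x"
          using chain_in_block[OF K'(2,1) xy(1) jk(1) 1 xy(2)] by auto
        show ?thesis
        proof (cases "S < real (width j)")
          case True
          then show ?thesis using * D by simp
        next
          case False
          then have "real (width j) ^ 2 \<le> S ^ 2" by (intro power_mono) auto
          then show ?thesis
            using dist_block_le[OF jk(1) *(1)] S unfolding D_def by (smt (verit) zero_less_power)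
        qed
      next
        case 2
        \<comment> \<open>This case is contradictory: \<open>x\<close> would lie in blocks of
          different indices.\<close>
        have "x \<in> block k" using chain_in_block(1)[OF K'(2,1) xy(2) jk(2) 2(1) xy(1)] .
        then have "j = k" using dist_distinct_blocks[of x k x j] jk(1) 2 S by force
        then show ?thesis using 2 by simp
      next
        case 3
        have *: "0 \<le> z \<and> z \<le> D" if "z \<in> block i" "real i \<le> S" for z i
        proof -
          have "real i ^ 3 + real i ^ 2 \<le> D"
            unfolding D_def using that S by (intro add_mono power_mono) auto
          moreover have "0 \<le> real i ^ 3" by simp
          ultimately show ?thesis
            using block_lower[OF that(1)] block_upper[OF that(1)] by linarith
        qed
        show ?thesis using *[OF jk(1) 3(1)] *[OF jk(2) 3(2)]
          unfolding dist_real_def by linarith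
      qed
    qed
    have "bounded K"
      unfolding bounded_two_points using dist by blast
    moreover have "diameter K \<le> D"
      using dist D by (intro diameter_le) (auto simp: dist_norm)
    ultimately show ?thesis ..
  qed
  then show "\<exists>D>0. \<forall>K. scale_component S (block_space A) K \<longrightarrow> bounded K \<and> diameter K \<le> D"
    using D by blast
qed

section \<open>Coarse equivalences preserve large widths\<close>

text \<open>Neighbours have images closer than the gap around \<open>block k\<close>, so membership
  in \<open>block k\<close> spreads along the progression, in both directions from
  \<open>x\<close>.\<close>

lemma image_block_subset:
  assumes h: "h \<in> block j \<rightarrow> block_space B"
    and M: "\<And>x y. x \<in> block j \<Longrightarrow> y \<in> block j \<Longrightarrow> dist x y = real (width j) \<Longrightarrow> dist (h x) (h y) \<le> M"
    and x: "x \<in> block j" "h x \<in> block k" "M < real k"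
  shows "h ` block j \<subseteq> block k"
proof -
  let ?Q = "\<lambda>i. h (block_point j i) \<in> block k"
  have step: "?Q (Suc i) \<longleftrightarrow> ?Q i" if i: "Suc i < width j" for i
  proof -
    have pts: "block_point j i \<in> block j" "block_point j (Suc i) \<in> block j"
      using i by (auto simp: block_def)
    have "dist (block_point j i) (block_point j (Suc i)) = real (width j)"
      by (simp add: dist_block_points)
    then have d: "dist (h (block_point j i)) (h (block_point j (Suc i))) < real k"
      using M[OF pts] x(3) by linarith
    obtain a b where "h (block_point j i) \<in> block a" "h (block_point j (Suc i)) \<in> block b"
      using h pts in_block_space by (metis Pi_mem)
    then show ?thesis
      using d dist_distinct_blocks[of _ k] by (metis dist_commute not_less)
  qed
  have const: "?Q i \<longleftrightarrow> ?Q 0" if "i < width j" for i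
    using that by (induction i) (auto simp: step)
  obtain i where i: "i < width j" "x = block_point j i" using x(1) by (auto simp: block_def)
  then have "?Q 0" using const[OF i(1)] x(2) by metis
  then have "?Q i" if "i < width j" for i using const[OF that] by blast
  then show ?thesis by (auto simp: block_def)
qed

text \<open>Points with a common image under \<open>f\<close> are both within \<open>C\<close> of
  the same point, hence closer than one step of the block.\<close>

lemma inj_on_block:
  assumes C: "\<And>x. x \<in> block j \<Longrightarrow> dist (g (f x)) x \<le> C" and "2 * C < real (width j)"
  shows "inj_on f (block j)"
proof (rule inj_onI, rule ccontr)
  fix x y assume xy: "x \<in> block j" "y \<in> block j" "f x = f y" "x \<noteq> y"
  have "dist x y \<le> dist (g (f x)) x + dist (g (f y)) y"
    using dist_triangle3[of x y "g (f x)"] xy(3) by simp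
  then show False
    using C[OF xy(1)] C[OF xy(2)] dist_within_block[OF xy(1,2,4)] assms(2) by linarith
qed

text \<open>The threshold for \<open>n\<close> depends on \<open>C\<close> alone; the moduli and
  properness only decide how far out the block is taken.\<close>

lemma width_transfer:
  assumes "0 < C" and f: "coarse_map (block_space A) (block_space B) f"
    and g: "coarse_map (block_space B) (block_space A) g"
    and gf: "\<forall>x\<in>block_space A. dist (g (f x)) x \<le> C"
    and fg: "\<forall>y\<in>block_space B. dist (f (g y)) y \<le> C"
    and n: "n \<in> A" "2 \<le> n" "2 * C < real n"
  shows "n \<in> B"
proof -
  obtain \<delta> where \<delta>: "\<delta> \<in> {0..} \<rightarrow> {0::real..}"
    "\<And>x y. x \<in> block_space A \<Longrightarrow> y \<in> block_space A \<Longrightarrow> dist (f x) (f y) \<le> \<delta> (dist x y)"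
    using f unfolding coarse_map_def large_scale_uniform_def by blast
  obtain \<epsilon> where \<epsilon>: "mono_on {0..} \<epsilon>"
    "\<And>x y. x \<in> block_space B \<Longrightarrow> y \<in> block_space B \<Longrightarrow> dist (g x) (g y) \<le> \<epsilon> (dist x y)"
    using g unfolding coarse_map_def large_scale_uniform_def by blast
  have fX: "f \<in> block_space A \<rightarrow> block_space B" and gX: "g \<in> block_space B \<rightarrow> block_space A"
    using f g by (auto simp: coarse_map_def)
  \<comment> \<open>\<open>M\<close> bounds how far apart \<open>f\<close> sends neighbours in any
    block of width \<open>n\<close>; beyond \<open>T\<close> all blocks have index above
    \<open>M\<close>.\<close>
  define M where "M = \<delta> (real n)"
  have M: "0 \<le> M" using \<delta>(1) by (auto simp: M_def)
  define T where "T = M ^ 3 + M ^ 2"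
  have "bounded (block_space B \<inter> {0..T})"
    by (rule bounded_subset[OF bounded_closed_interval]) auto
  then have "bounded (f -` (block_space B \<inter> {0..T}) \<inter> block_space A)"
    using f unfolding coarse_map_def metrically_proper_def by blast
  then obtain R where
    bound: "\<And>x. x \<in> f -` (block_space B \<inter> {0..T}) \<inter> block_space A \<Longrightarrow> \<bar>x\<bar> \<le> R"
    unfolding bounded_iff real_norm_def by blast
  have R: "x \<le> R" if "x \<in> block_space A" "f x \<in> {0..T}" for x
    using bound[of x] that Pi_mem[OF fX that(1)] by auto
  \<comment> \<open>Exceeding \<open>R\<close> pushes \<open>f x0\<close> beyond \<open>T\<close>,
    exceeding \<open>C\<close> keeps \<open>g (f x0)\<close> in \<open>block j\<close>, and
    exceeding \<open>\<epsilon> M\<close> makes \<open>g\<close> map \<open>block k\<close> into one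
    block.\<close>
  obtain i :: nat where "max R (max C (\<epsilon> M)) < real i" using reals_Archimedean2 by blast
  then have i: "R < real i" "C < real i" "\<epsilon> M < real i" by simp_all
  define j where "j = prod_encode (n, i)"
  have wj: "width j = n" by (simp add: j_def)
  have "real i \<le> real j" by (simp add: j_def le_prod_encode_2)
  then have j: "R < real j" "C < real j" "\<epsilon> M < real j" using i by linarith+
  have subA: "block j \<subseteq> block_space A" using block_subset_space wj n(1) by simp
  define x0 x1 where "x0 = block_point j 0" and "x1 = block_point j 1"
  have x: "x0 \<in> block j" "x1 \<in> block j" "dist x0 x1 = real n"
    using n(2) wj by (auto simp: x0_def x1_def block_def dist_block_points)
  obtain k where k: "width k \<in> B" "f x0 \<in> block k"
    using fX subA x(1) in_block_space by (metis Pi_mem subsetD)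
  have subB: "block k \<subseteq> block_space B" using block_subset_space k(1) by simp
  have "real j \<le> real j ^ 3"
    using self_le_power[of "real j" 3] by (cases j) auto
  then have "R < x0" using block_lower[OF x(1)] j(1) by linarith
  then have "f x0 \<notin> {0..T}" using R x(1) subA by force
  then have "T < f x0" using k(2) subB block_space_nonneg by fastforce
  then have kM: "M < real k" using block_index_gt[OF k(2)] M by (simp add: T_def)
  have "f \<in> block j \<rightarrow> block_space B" using fX subA by auto
  moreover have "dist (f y) (f z) \<le> M"
    if "y \<in> block j" "z \<in> block j" "dist y z = real (width j)" for y z
    using that \<delta>(2)[of y z] subA wj by (auto simp: M_def)
  ultimately have fj: "f ` block j \<subseteq> block k" using image_block_subset x(1) k(2) kM by blast
  have injf: "inj_on f (block j)"
    using inj_on_block[of j g f C] gf subA n(3) wj by auto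
  have nm: "n \<le> width k"
    using card_inj_on_le[OF injf fj finite_block] wj by (simp add: card_block)
  \<comment> \<open>Two distinct images in \<open>block k\<close> force its step to be at most
    \<open>M\<close>. So \<open>\<epsilon> M\<close>, fixed before \<open>k\<close> was known,
    controls \<open>g\<close> on neighbours in \<open>block k\<close>.\<close>
  have "x0 \<noteq> x1" using x(3) n(2) by auto
  then have "f x0 \<noteq> f x1" using injf x by (meson inj_onD)
  then have "real (width k) \<le> dist (f x0) (f x1)"
    using dist_within_block[OF k(2)] fj x(2) by blast
  also have "\<dots> \<le> M" using \<delta>(2)[of x0 x1] subA x by (auto simp: M_def)
  finally have wM: "\<epsilon> (width k) \<le> \<epsilon> M" using M by (intro mono_onD[OF \<epsilon>(1)]) auto
  have "g (f x0) \<in> block_space A" using gX k(2) subB by auto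
  then obtain l where l: "g (f x0) \<in> block l" using in_block_space by blast
  have "dist x0 (g (f x0)) < real j" using gf subA x(1) j(2) by (force simp: dist_commute)
  then have gx0: "g (f x0) \<in> block j" using dist_distinct_blocks[OF x(1) l] l by force
  have "g \<in> block k \<rightarrow> block_space A" using gX subB by auto
  moreover have "dist (g y) (g z) \<le> \<epsilon> M"
    if "y \<in> block k" "z \<in> block k" "dist y z = real (width k)" for y z
    using \<epsilon>(2)[OF subsetD[OF subB that(1)] subsetD[OF subB that(2)]] that(3) wM by simp
  ultimately have gk: "g ` block k \<subseteq> block j"
    using image_block_subset[of g k A "\<epsilon> M"] k(2) gx0 j(3) by blast
  have "inj_on g (block k)"
    using inj_on_block[of k f g C] fg subB n(3) nm by auto
  then have "width k \<le> n"
    using card_inj_on_le[OF _ gk finite_block] wj by (simp add: card_block)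
  then show ?thesis using nm k(1) by simp
qed

section \<open>The uncountable family\<close>

lemma coarsely_equivalent_sym:
  "coarsely_equivalent X Y \<Longrightarrow> coarsely_equivalent Y X"
  unfolding coarsely_equivalent_def by blast

lemma coarsely_equivalent_refl: "coarsely_equivalent X X"
proof -
  have "coarse_map X X (\<lambda>x. x)"
    unfolding coarse_map_def metrically_proper_def large_scale_uniform_def
    by (auto simp: mono_on_def Int_absorb2 intro!: exI[of _ "\<lambda>x. x"])
  then show ?thesis
    unfolding coarsely_equivalent_def by (intro exI[of _ 1] conjI exI[of _ "\<lambda>x. x"]) auto
qed

text \<open>Inclusion up to finitely many elements suffices, as coarse equivalence is
  symmetric.\<close>

lemma coarsely_equivalent_block_spaces:
  assumes "coarsely_equivalent (block_space A) (block_space B)"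
  shows "\<exists>N. \<forall>n\<ge>N. n \<in> A \<longrightarrow> n \<in> B"
proof -
  obtain C f g where *: "0 < C" "coarse_map (block_space A) (block_space B) f"
    "coarse_map (block_space B) (block_space A) g"
    "\<forall>x\<in>block_space A. dist (g (f x)) x \<le> C" "\<forall>y\<in>block_space B. dist (f (g y)) y \<le> C"
    using assms unfolding coarsely_equivalent_def by blast
  obtain N :: nat where "2 * C < real N" using reals_Archimedean2 by blast
  then have "\<forall>n\<ge>max 2 N. n \<in> A \<longrightarrow> n \<in> B" using width_transfer[OF *] by auto
  then show ?thesis by blast
qed

text \<open>
  Each \<open>i \<in> S\<close> contributes infinitely many elements to the set of widths, so distinct \<open>S\<close> give
  sets with infinite symmetric difference.
\<close>

definition coded_space :: "nat set \<Rightarrow> real set" where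
  "coded_space S = block_space {n. fst (prod_decode n) \<in> S}"

lemma coarsely_equivalent_coded_spaces:
  assumes "coarsely_equivalent (coded_space S) (coded_space T)"
  shows "S = T"
proof -
  have "S \<subseteq> T" if eq: "coarsely_equivalent (coded_space S) (coded_space T)" for S T
  proof
    fix i assume "i \<in> S"
    obtain N where "\<forall>n\<ge>N. fst (prod_decode n) \<in> S \<longrightarrow> fst (prod_decode n) \<in> T"
      using coarsely_equivalent_block_spaces[OF eq[unfolded coded_space_def]] by auto
    \<comment> \<open>This code has first coordinate \<open>i\<close> and is at least
      \<open>N\<close>.\<close>
    from this[rule_format, of "prod_encode (i, N)"] show "i \<in> T"
      using \<open>i \<in> S\<close> by (simp add: le_prod_encode_2)
  qed
  then show ?thesis using assms coarsely_equivalent_sym by blast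
qed

theorem corollary6p4:
  shows "\<exists>\<F> :: real set set.
     uncountable \<F> \<and>
     (\<forall>X\<in>\<F>. X \<subseteq> {0..} \<and> asdim_zero X) \<and>
     pairwise (\<lambda>X Y. \<not> coarsely_equivalent X Y) \<F>"
proof (intro exI conjI)
  \<comment> \<open>Equal spaces are coarsely equivalent by reflexivity, so they have equal
    codes.\<close>
  have "inj coded_space"
    by (metis injI coarsely_equivalent_coded_spaces coarsely_equivalent_refl)
  moreover have "uncountable (UNIV :: nat set set)"
    unfolding uncountable_def using Cantors_theorem[of "UNIV :: nat set"] by auto
  ultimately show "uncountable (range coded_space)"
    using countable_image_inj_on by blast
  show "\<forall>X\<in>range coded_space. X \<subseteq> {0..} \<and> asdim_zero X"
    using asdim_zero_block_space block_space_nonneg by (auto simp: coded_space_def)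
  show "pairwise (\<lambda>X Y. \<not> coarsely_equivalent X Y) (range coded_space)"
    using coarsely_equivalent_coded_spaces by (auto simp: pairwise_def)
qed

end
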